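(* Let $\mathcal{X}$ be a finite-dimensional Euclidean space, $f:\mathcal{X}\to\mathbb{R}$, $\mathbf{g}=(\mathbf{g}_1,\dots,\mathbf{g}_m)$ with $\mathbf{g}_j:\mathcal{X}\to\mathbb{R}^d$, $\kappa\in(0,1)$, $r(\mathbf{x})=\sum_{j=1}^m\|\mathbf{g}_j(\mathbf{x})\|$ and $\phi=f+\kappa\, r$. Assume: (a1) $f$ is differentiable (possibly nonconvex) and $\nabla f$ is $L_f$-Lipschitz continuous; (a2) every component of $\mathbf{g}$ is differentiable (possibly nonconvex) and $\nabla\mathbf{g}$ is $L_g$-Lipschitz continuous; (a3) $\sup_{\mathbf{x}\in\mathcal{X}}\|\nabla\mathbf{g}(\mathbf{x})\|\le M$ for some constant $M>0$; (a4) $\phi$ is coercive and $\phi^*=\min_{\mathbf{x}\in\mathcal{X}}\phi(\mathbf{x})>-\infty$. Suppose $\{\mathbf{x}_t\}$ is the sequence generated by the Algorithm described in the context with any initial $\mathbf{x}_0\in\mathcal{X}$, $\epsilon_{\mathrm{tol}}=0$ and $T=\infty$. Let $\{\mathbf{x}_{t_l+1}\}_{l=1,2,\dots}$ be the subsequence of iterates satisfying the reduction criterion of the Algorithm, i.e. $\|\nabla\phi_{\varepsilon_{t}}(\mathbf{x}_{t+1})\|<\sigma\gamma\varepsilon_{t}$ for $t=t_l$, $l=1,2,\dots$. Then $\{\mathbf{x}_{t_l+1}\}$ has at least one accumulation point, and every accumulation point of $\{\mathbf{x}_{t_l+1}\}$ is a Clarke stationary point of $\min_{\mathbf{x}}\phi(\mathbf{x})$,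 $\phi(\mathbf{x})=f(\mathbf{x})+\kappa\, r(\mathbf{x})$.
   Context: For $\varepsilon>0$ put $r_\varepsilon(\mathbf{x})=\sum_{j=1}^m\sqrt{\|\mathbf{g}_j(\mathbf{x})\|^2+\varepsilon^2}-\varepsilon$, $R_\varepsilon=\kappa\, r_\varepsilon$, and $\phi_\varepsilon=f+R_\varepsilon$ (only $\nabla\phi_\varepsilon$ and differences of $\phi_\varepsilon$ with the same $\varepsilon$ are used by the Algorithm). In the paper the weight is $\kappa=\sigma(\omega_i)$, the value of the sigmoid function at a fixed real parameter $\omega_i$. A point $\hat{\mathbf{x}}$ is a Clarke stationary point of $\phi$ if $0\in\partial\phi(\hat{\mathbf{x}})$, where $\partial$ is the Clarke subdifferential. Algorithm. Input: initial $\mathbf{x}_0$; constants $0<\rho,\gamma<1$ and $\varepsilon_0,a,\sigma>0$; maximal number of phases $T$ or tolerance $\epsilon_{\mathrm{tol}}\ge 0$; step sizes $\alpha_t,\beta_t>0$ with $\tau_t=\frac{\alpha_t\beta_t}{\alpha_t+\beta_t}$. For $t=0,1,2,\dots,T-1$: 1. $\mathbf{z}_{t+1}=\mathbf{x}_t-\alpha_t\nabla f(\mathbf{x}_t)$ and $\mathbf{u}_{t+1}=\mathbf{z}_{t+1}-\tau_t\nabla R_{\varepsilon_t}(\mathbf{z}_{t+1})$. 2. If $\|\nabla\phi_{\varepsilon_t}(\mathbf{x}_t)\|\le a\|\mathbf{u}_{t+1}-\mathbf{x}_t\|$ and $\phi_{\varepsilon_t}(\mathbf{u}_{t+1})-\phi_{\varepsilon_t}(\mathbf{x}_t)\le-\frac1a\|\mathbf{u}_{t+1}-\mathbf{x}_t\|^2$,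 set $\mathbf{x}_{t+1}=\mathbf{u}_{t+1}$. 3. Otherwise (line search): compute $\mathbf{v}_{t+1}=\mathbf{x}_t-\alpha_t\nabla\phi_{\varepsilon_t}(\mathbf{x}_t)$; if $\phi_{\varepsilon_t}(\mathbf{v}_{t+1})-\phi_{\varepsilon_t}(\mathbf{x}_t)\le-\frac1a\|\mathbf{v}_{t+1}-\mathbf{x}_t\|^2$, set $\mathbf{x}_{t+1}=\mathbf{v}_{t+1}$; else replace $\alpha_t$ by $\rho\alpha_t$ and repeat step 3. 4. (Reduction criterion) If $\|\nabla\phi_{\varepsilon_t}(\mathbf{x}_{t+1})\|<\sigma\gamma\varepsilon_t$, set $\varepsilon_{t+1}=\gamma\varepsilon_t$; otherwise set $\varepsilon_{t+1}=\varepsilon_t$. 5. If $\sigma\varepsilon_t<\epsilon_{\mathrm{tol}}$, terminate. *)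

theory Defs
  imports "HOL-Analysis.Analysis"
begin

definition grad :: "('a::real_inner \<Rightarrow> real) \<Rightarrow> 'a \<Rightarrow> 'a" where
  "grad F x = (THE D. GDERIV F x :> D)"

(* Generalized directional derivative
   limsup_{y -> x, t -> 0+} (F (y + t v) - F y) / t;  the base point y = x is allowed. *)
definition clarke_dderiv :: "('a::real_normed_vector \<Rightarrow> real) \<Rightarrow> 'a \<Rightarrow> 'a \<Rightarrow> ereal" where
  "clarke_dderiv F x v =
     Limsup (nhds x \<times>\<^sub>F at_right 0) (\<lambda>(y, t). ereal ((F (y + t *\<^sub>R v) - F y) / t))"

definition clarke_subdiff :: "('a::real_inner \<Rightarrow> real) \<Rightarrow> 'a \<Rightarrow> 'a set" where
  "clarke_subdiff F x = {w. \<forall>v. ereal (w \<bullet> v) \<le> clarke_dderiv F x v}"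

definition clarke_stationary :: "('a::real_inner \<Rightarrow> real) \<Rightarrow> 'a \<Rightarrow> bool" where
  "clarke_stationary F x \<longleftrightarrow> 0 \<in> clarke_subdiff F x"

definition accumulation_point :: "(nat \<Rightarrow> 'a::topological_space) \<Rightarrow> 'a \<Rightarrow> bool" where
  "accumulation_point y p \<longleftrightarrow> (\<exists>q. strict_mono q \<and> (y \<circ> q) \<longlonglongrightarrow> p)"

definition coercive :: "('a::real_normed_vector \<Rightarrow> real) \<Rightarrow> bool" where
  "coercive F \<longleftrightarrow> filterlim F at_top at_infinity"

(* The blocks g_j are the components g x $ j, so the norm on the codomain of g is the
   Euclidean norm of the concatenated vector. *)
definition reg :: "('a \<Rightarrow> (real^'d)^'m) \<Rightarrow> 'a \<Rightarrow> real" where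
  "reg g x = (\<Sum>j\<in>UNIV. norm (g x $ j))"

definition reg_smooth :: "('a \<Rightarrow> (real^'d)^'m) \<Rightarrow> real \<Rightarrow> 'a \<Rightarrow> real" where
  "reg_smooth g \<epsilon> x = (\<Sum>j\<in>UNIV. (sqrt ((norm (g x $ j))\<^sup>2 + \<epsilon>\<^sup>2) - \<epsilon>))"

definition objective :: "('a \<Rightarrow> real) \<Rightarrow> real \<Rightarrow> ('a \<Rightarrow> (real^'d)^'m) \<Rightarrow> 'a \<Rightarrow> real" where
  "objective f \<kappa> g x = f x + \<kappa> * reg g x"

definition weighted_reg_smooth :: "real \<Rightarrow> ('a \<Rightarrow> (real^'d)^'m) \<Rightarrow> real \<Rightarrow> 'a \<Rightarrow> real" where
  "weighted_reg_smooth \<kappa> g \<epsilon> x = \<kappa> * reg_smooth g \<epsilon> x"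

definition objective_smooth ::
    "('a \<Rightarrow> real) \<Rightarrow> real \<Rightarrow> ('a \<Rightarrow> (real^'d)^'m) \<Rightarrow> real \<Rightarrow> 'a \<Rightarrow> real" where
  "objective_smooth f \<kappa> g \<epsilon> x = f x + weighted_reg_smooth \<kappa> g \<epsilon> x"

definition sufficient_decrease ::
    "('a::real_normed_vector \<Rightarrow> real) \<Rightarrow> real \<Rightarrow> 'a \<Rightarrow> 'a \<Rightarrow> bool" where
  "sufficient_decrease F a x y \<longleftrightarrow> F y - F x \<le> - (1 / a) * (norm (y - x))\<^sup>2"

(* line_search F a \<rho> x \<alpha> y: backtracking from the point x with trial step size \<alpha>
   terminates and returns y. *)
inductive line_search ::
    "('a::real_inner \<Rightarrow> real) \<Rightarrow> real \<Rightarrow> real \<Rightarrow> 'a \<Rightarrow> real \<Rightarrow> 'a \<Rightarrow> bool"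
  for F a \<rho> x where
  accept: "sufficient_decrease F a x (x - \<alpha> *\<^sub>R grad F x) \<Longrightarrow>
             line_search F a \<rho> x \<alpha> (x - \<alpha> *\<^sub>R grad F x)"
| backtrack: "\<not> sufficient_decrease F a x (x - \<alpha> *\<^sub>R grad F x) \<Longrightarrow>
             line_search F a \<rho> x (\<rho> * \<alpha>) y \<Longrightarrow> line_search F a \<rho> x \<alpha> y"

definition candidate ::
    "('a::real_inner \<Rightarrow> real) \<Rightarrow> real \<Rightarrow> ('a \<Rightarrow> (real^'d)^'m) \<Rightarrow> real \<Rightarrow> real \<Rightarrow> real \<Rightarrow> 'a \<Rightarrow> 'a"
  where
  "candidate f \<kappa> g \<epsilon> \<alpha> \<beta> x =
     (let \<tau> = \<alpha> * \<beta> / (\<alpha> + \<beta>);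
          z = x - \<alpha> *\<^sub>R grad f x
      in z - \<tau> *\<^sub>R grad (weighted_reg_smooth \<kappa> g \<epsilon>) z)"

definition iterate_step ::
    "('a::real_inner \<Rightarrow> real) \<Rightarrow> real \<Rightarrow> ('a \<Rightarrow> (real^'d)^'m) \<Rightarrow> real \<Rightarrow> real \<Rightarrow>
     real \<Rightarrow> real \<Rightarrow> real \<Rightarrow> 'a \<Rightarrow> 'a \<Rightarrow> bool" where
  "iterate_step f \<kappa> g a \<rho> \<epsilon> \<alpha> \<beta> x x' \<longleftrightarrow>
     (let F = objective_smooth f \<kappa> g \<epsilon>;
          u = candidate f \<kappa> g \<epsilon> \<alpha> \<beta> x
      in if norm (grad F x) \<le> a * norm (u - x) \<and> sufficient_decrease F a x u
         then x' = u
         else line_search F a \<rho> x \<alpha> x')"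

definition reduction_criterion ::
    "('a::real_inner \<Rightarrow> real) \<Rightarrow> real \<Rightarrow> ('a \<Rightarrow> (real^'d)^'m) \<Rightarrow> real \<Rightarrow> real \<Rightarrow>
     (nat \<Rightarrow> 'a) \<Rightarrow> (nat \<Rightarrow> real) \<Rightarrow> nat \<Rightarrow> bool" where
  "reduction_criterion f \<kappa> g \<sigma> \<gamma> x \<epsilon> t \<longleftrightarrow>
     norm (grad (objective_smooth f \<kappa> g (\<epsilon> t)) (x (t + 1))) < \<sigma> * \<gamma> * \<epsilon> t"

(* The sequences x and \<epsilon> are an infinite run (no bound on the number of phases, and the
   test \<sigma> * \<epsilon> t < tol never succeeds) with starting values x0 and \<epsilon>0.  \<alpha> t and \<beta> t are the
   step sizes with which phase t starts; backtracking changes the step size only within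
   that phase.  As \<alpha> is an arbitrary sequence, the variant in which the reduced step size is
   carried over to the next phase is included. *)
definition generated_by_algorithm ::
    "('a::real_inner \<Rightarrow> real) \<Rightarrow> real \<Rightarrow> ('a \<Rightarrow> (real^'d)^'m) \<Rightarrow>
     real \<Rightarrow> real \<Rightarrow> real \<Rightarrow> real \<Rightarrow> (nat \<Rightarrow> real) \<Rightarrow> (nat \<Rightarrow> real) \<Rightarrow> real \<Rightarrow>
     'a \<Rightarrow> real \<Rightarrow> (nat \<Rightarrow> 'a) \<Rightarrow> (nat \<Rightarrow> real) \<Rightarrow> bool" where
  "generated_by_algorithm f \<kappa> g a \<rho> \<sigma> \<gamma> \<alpha> \<beta> tol x0 \<epsilon>0 x \<epsilon> \<longleftrightarrow>
     x 0 = x0 \<and> \<epsilon> 0 = \<epsilon>0 \<and>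
     (\<forall>t. iterate_step f \<kappa> g a \<rho> (\<epsilon> t) (\<alpha> t) (\<beta> t) (x t) (x (t + 1)) \<and>
          \<epsilon> (t + 1) = (if reduction_criterion f \<kappa> g \<sigma> \<gamma> x \<epsilon> t then \<gamma> * \<epsilon> t else \<epsilon> t) \<and>
          \<not> \<sigma> * \<epsilon> t < tol)"

end

theory Submission
  imports Defs
begin

text \<open>
  Existence of an accumulation point: write \<open>P \<epsilon> y = f y + \<kappa> * (\<Sum>j. sqrt (norm (g y $ j)\<^sup>2 + \<epsilon>\<^sup>2))\<close>,
  which is the smoothed objective plus a constant depending only on \<open>\<epsilon>\<close>.  Every step of the
  algorithm is accepted by a sufficient decrease test, so it does not increase \<open>P (\<epsilon> t)\<close>; and \<open>P\<close>
  is monotone in \<open>\<epsilon> \<ge> 0\<close>, while \<open>\<epsilon> t\<close> is nonincreasing.  Hence \<open>P (\<epsilon> t) (x t)\<close> is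
  nonincreasing.  It dominates the objective at \<open>x t\<close>, so the iterates stay in a sublevel set of the
  objective, which is bounded by coercivity.

  Stationarity: every reduction multiplies \<open>\<epsilon>\<close> by \<open>\<gamma> < 1\<close>, so along the reduction steps
  \<open>\<epsilon>\<close> and with it the gradients of the smoothed objectives tend to \<open>0\<close>.  Let \<open>p\<close> be an
  accumulation point and \<open>v\<close> a direction.  It suffices to bound the one-sided directional derivative
  of the objective at \<open>p\<close> from below by \<open>0\<close>, because the generalized directional derivative
  dominates it (take the base point \<open>y = p\<close> in the upper limit).  A block with \<open>g p $ j = 0\<close>
  contributes \<open>norm (g' p v $ j)\<close> to it, a block with \<open>g p $ j \<noteq> 0\<close> contributes
  \<open>(g p $ j \<bullet> g' p v $ j) / norm (g p $ j)\<close>.  In the derivative of the smoothed objective a block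
  contributes \<open>(g y $ j \<bullet> g' y v $ j) / sqrt (norm (g y $ j)\<^sup>2 + \<epsilon>\<^sup>2)\<close>.  For \<open>y\<close> tending to
  \<open>p\<close> and \<open>\<epsilon>\<close> to \<open>0\<close> this converges to the right value if \<open>g p $ j \<noteq> 0\<close>; if \<open>g p $ j = 0\<close> it
  need not converge, but it is at most \<open>norm (g' y v $ j)\<close> by Cauchy--Schwarz, which does converge.
  So the directional derivative is at least the limit of the smoothed ones, which is \<open>0\<close>.
\<close>

section \<open>Gradients and one-sided directional derivatives\<close>

lemma inner_grad_eq:
  fixes F :: "'a::euclidean_space \<Rightarrow> real"
  assumes "(F has_derivative F') (at x)"
  shows "v \<bullet> grad F x = F' v"
proof -
  have "linear F'"
    using assms by (rule has_derivative_linear)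
  then have F': "h \<bullet> adjoint F' 1 = F' h" for h
    using adjoint_works[of F' h 1] by simp
  have D: "GDERIV F x :> adjoint F' 1"
    using assms by (simp add: gderiv_def F')
  have "D = adjoint F' 1" if "GDERIV F x :> D" for D
  proof -
    have "(\<lambda>h. h \<bullet> D) = (\<lambda>h. h \<bullet> adjoint F' 1)"
      using that D unfolding gderiv_def by (rule has_derivative_unique)
    then have "\<forall>h. h \<bullet> D = h \<bullet> adjoint F' 1"
      by (simp add: fun_eq_iff)
    then show ?thesis
      unfolding vector_eq_ldot .
  qed
  with D have "grad F x = adjoint F' 1"
    unfolding grad_def by (rule the_equality)
  then show ?thesis
    by (simp add: F')
qed

lemma directional_derivative_at_right:
  fixes h :: "'a::real_normed_vector \<Rightarrow> 'b::real_normed_vector"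
  assumes "(h has_derivative h') (at p)"
  shows "((\<lambda>t. (h (p + t *\<^sub>R v) - h p) /\<^sub>R t) \<longlongrightarrow> h' v) (at_right 0)"
proof -
  have "((\<lambda>t. h (p + t *\<^sub>R v)) has_derivative (\<lambda>t. h' (t *\<^sub>R v))) (at 0 within {0<..})"
    by (rule has_derivative_compose[where g = h and f = "\<lambda>t. p + t *\<^sub>R v"])
       (auto intro!: derivative_eq_intros assms)
  moreover have "h' (t *\<^sub>R v) = t *\<^sub>R h' v" for t
    using has_derivative_linear[OF assms] by (rule linear_cmul)
  ultimately have "((\<lambda>t. (h (p + t *\<^sub>R v) - h p - t *\<^sub>R h' v) /\<^sub>R norm t) \<longlongrightarrow> 0) (at_right 0)"
    by (simp add: has_derivative_within divide_inverse algebra_simps)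
  then have "((\<lambda>t. (h (p + t *\<^sub>R v) - h p - t *\<^sub>R h' v) /\<^sub>R norm t + h' v) \<longlongrightarrow> 0 + h' v) (at_right 0)"
    by (intro tendsto_intros)
  moreover have "eventually (\<lambda>t. (h (p + t *\<^sub>R v) - h p - t *\<^sub>R h' v) /\<^sub>R norm t + h' v
      = (h (p + t *\<^sub>R v) - h p) /\<^sub>R t) (at_right (0::real))"
    using eventually_at_right_less by eventually_elim (simp add: scaleR_diff_right)
  ultimately show ?thesis
    by (auto intro: Lim_transform_eventually)
qed

lemma directional_derivative_norm_at_right:
  fixes h :: "'a::real_normed_vector \<Rightarrow> 'b::real_inner"
  assumes h: "(h has_derivative h') (at p)"
  shows "((\<lambda>t. (norm (h (p + t *\<^sub>R v)) - norm (h p)) / t)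
    \<longlongrightarrow> (if h p = 0 then norm (h' v) else (h p \<bullet> h' v) / norm (h p))) (at_right 0)"
proof (cases "h p = 0")
  case True
  have "((\<lambda>t. norm ((h (p + t *\<^sub>R v) - h p) /\<^sub>R t)) \<longlongrightarrow> norm (h' v)) (at_right 0)"
    by (intro tendsto_norm directional_derivative_at_right h)
  moreover have "eventually (\<lambda>t. norm ((h (p + t *\<^sub>R v) - h p) /\<^sub>R t)
      = (norm (h (p + t *\<^sub>R v)) - norm (h p)) / t) (at_right (0::real))"
    using eventually_at_right_less
    by eventually_elim (simp add: True divide_inverse mult.commute)
  ultimately show ?thesis
    using True by (auto intro: Lim_transform_eventually)
next
  case False
  have "((\<lambda>y. norm (h y)) has_derivative (\<lambda>v. h' v \<bullet> sgn (h p))) (at p)"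
    by (rule has_derivative_compose[OF h has_derivative_norm[OF False]])
  from directional_derivative_at_right[OF this, of v] False show ?thesis
    by (simp add: sgn_div_norm inner_commute divide_inverse mult.commute)
qed

text \<open>The upper limit is taken over a filter that is coarser than the one along the ray from the
  base point \<open>p\<close> itself.\<close>

lemma clarke_dderiv_ge:
  assumes "((\<lambda>t. (F (p + t *\<^sub>R v) - F p) / t) \<longlongrightarrow> D) (at_right 0)"
  shows "ereal D \<le> clarke_dderiv F p v"
proof -
  let ?h = "\<lambda>(y, t). ereal ((F (y + t *\<^sub>R v) - F y) / t)"
  have lim: "((\<lambda>t. ?h (p, t)) \<longlongrightarrow> ereal D) (at_right 0)"
    using assms by simp
  have "filterlim (Pair p) (nhds p \<times>\<^sub>F at_right 0) (at_right (0::real))"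
    by (intro filterlim_Pair tendsto_const filterlim_ident)
  then have line: "eventually (\<lambda>t. P (p, t)) (at_right 0)"
    if "eventually P (nhds p \<times>\<^sub>F at_right (0::real))" for P
    using that by (rule eventually_compose_filterlim[rotated])
  show ?thesis
    unfolding clarke_dderiv_def Limsup_def
  proof (rule INF_greatest)
    fix P
    assume "P \<in> {P. eventually P (nhds p \<times>\<^sub>F at_right (0::real))}"
    then have "eventually (\<lambda>t. P (p, t)) (at_right 0)"
      using line by simp
    then have "eventually (\<lambda>t. ?h (p, t) \<le> (SUP z\<in>Collect P. ?h z)) (at_right 0)"
      by eventually_elim (rule SUP_upper, simp)
    then show "ereal D \<le> (SUP z\<in>Collect P. ?h z)"
      using lim by (intro tendsto_upperbound) auto
  qed
qed

section \<open>The smoothed objective\<close>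

lemma has_derivative_sqrt_smoothed_norm:
  fixes h :: "'a::real_normed_vector \<Rightarrow> 'b::real_inner"
  assumes h: "(h has_derivative h') (at y)" and "\<epsilon> > 0"
  shows "((\<lambda>y. sqrt ((norm (h y))\<^sup>2 + \<epsilon>\<^sup>2)) has_derivative
    (\<lambda>v. (h y \<bullet> h' v) / sqrt ((norm (h y))\<^sup>2 + \<epsilon>\<^sup>2))) (at y)"
proof -
  have "h y \<bullet> h y + \<epsilon>\<^sup>2 > 0"
    using \<open>\<epsilon> > 0\<close> by (simp add: add_nonneg_pos)
  then show ?thesis
    unfolding power2_norm_eq_inner
    by (auto intro!: derivative_eq_intros h simp: inner_commute field_simps)
qed

lemma inner_grad_objective_smooth:
  fixes f :: "'a::euclidean_space \<Rightarrow> real" and g :: "'a \<Rightarrow> (real^'d)^'m"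
  assumes f: "f differentiable (at y)" and g: "(g has_derivative g') (at y)" and e: "\<epsilon> > 0"
  shows "v \<bullet> grad (objective_smooth f \<kappa> g \<epsilon>) y
    = v \<bullet> grad f y + \<kappa> * (\<Sum>j\<in>UNIV. (g y $ j \<bullet> g' v $ j) / sqrt ((norm (g y $ j))\<^sup>2 + \<epsilon>\<^sup>2))"
proof -
  obtain f' where f': "(f has_derivative f') (at y)"
    using f by (auto simp: differentiable_def)
  have gj: "((\<lambda>y. g y $ j) has_derivative (\<lambda>v. g' v $ j)) (at y)" for j
    using bounded_linear.has_derivative[OF bounded_linear_vec_nth g] .
  have "(objective_smooth f \<kappa> g \<epsilon> has_derivative (\<lambda>v. f' v
      + \<kappa> * (\<Sum>j\<in>UNIV. (g y $ j \<bullet> g' v $ j) / sqrt ((norm (g y $ j))\<^sup>2 + \<epsilon>\<^sup>2) - 0))) (at y)"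
    unfolding objective_smooth_def[abs_def] weighted_reg_smooth_def reg_smooth_def
    by (intro has_derivative_add has_derivative_mult_right has_derivative_sum has_derivative_diff
        has_derivative_const has_derivative_sqrt_smoothed_norm f' gj e)
  from inner_grad_eq[OF this, of v] inner_grad_eq[OF f', of v] show ?thesis
    by simp
qed

text \<open>The smoothed objective without the terms \<open>- \<epsilon>\<close>: for fixed \<open>\<epsilon>\<close> the two differ by a constant, but
  (for \<open>\<kappa> \<ge> 0\<close>) this one is nondecreasing in \<open>\<epsilon> \<ge> 0\<close>, whereas the smoothed objective is
  nonincreasing.\<close>

definition shifted_objective ::
    "('a \<Rightarrow> real) \<Rightarrow> real \<Rightarrow> ('a \<Rightarrow> (real^'d)^'m) \<Rightarrow> real \<Rightarrow> 'a \<Rightarrow> real" where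
  "shifted_objective f \<kappa> g \<epsilon> y = f y + \<kappa> * (\<Sum>j\<in>UNIV. sqrt ((norm (g y $ j))\<^sup>2 + \<epsilon>\<^sup>2))"

lemma shifted_objective_eq:
  fixes g :: "'a \<Rightarrow> (real^'d)^'m"
  shows "shifted_objective f \<kappa> g \<epsilon> y = objective_smooth f \<kappa> g \<epsilon> y + \<kappa> * CARD('m) * \<epsilon>"
  by (simp add: shifted_objective_def objective_smooth_def weighted_reg_smooth_def reg_smooth_def
      sum_subtractf algebra_simps)

lemma shifted_objective_mono:
  assumes "0 \<le> \<kappa>" "0 \<le> \<epsilon>'" "\<epsilon>' \<le> \<epsilon>"
  shows "shifted_objective f \<kappa> g \<epsilon>' y \<le> shifted_objective f \<kappa> g \<epsilon> y"
  unfolding shifted_objective_def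
  using assms by (intro add_left_mono mult_left_mono sum_mono) (auto intro: power_mono)

lemma shifted_objective_zero: "shifted_objective f \<kappa> g 0 y = objective f \<kappa> g y"
  by (simp add: shifted_objective_def objective_def reg_def)

section \<open>Stationarity of limit points\<close>

lemma objective_directional_derivative:
  fixes f :: "'a::euclidean_space \<Rightarrow> real" and g :: "'a \<Rightarrow> (real^'d)^'m"
  assumes f: "f differentiable (at p)" and g: "(g has_derivative g') (at p)"
  shows "((\<lambda>t. (objective f \<kappa> g (p + t *\<^sub>R v) - objective f \<kappa> g p) / t) \<longlongrightarrow>
    v \<bullet> grad f p + \<kappa> * (\<Sum>j\<in>UNIV. if g p $ j = 0 then norm (g' v $ j)
                             else (g p $ j \<bullet> g' v $ j) / norm (g p $ j))) (at_right 0)"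
proof -
  obtain f' where f': "(f has_derivative f') (at p)"
    using f by (auto simp: differentiable_def)
  have gj: "((\<lambda>y. g y $ j) has_derivative (\<lambda>v. g' v $ j)) (at p)" for j
    using bounded_linear.has_derivative[OF bounded_linear_vec_nth g] .
  have "((\<lambda>t. (f (p + t *\<^sub>R v) - f p) / t) \<longlongrightarrow> v \<bullet> grad f p) (at_right 0)"
    using directional_derivative_at_right[OF f', of v]
    by (simp add: inner_grad_eq[OF f'] divide_inverse mult.commute)
  then have "((\<lambda>t. (f (p + t *\<^sub>R v) - f p) / t
        + \<kappa> * (\<Sum>j\<in>UNIV. (norm (g (p + t *\<^sub>R v) $ j) - norm (g p $ j)) / t)) \<longlongrightarrow>
    v \<bullet> grad f p + \<kappa> * (\<Sum>j\<in>UNIV. if g p $ j = 0 then norm (g' v $ j)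
                             else (g p $ j \<bullet> g' v $ j) / norm (g p $ j))) (at_right 0)"
    by (intro tendsto_add tendsto_mult_left tendsto_sum directional_derivative_norm_at_right gj)
  moreover have "(\<lambda>t. (f (p + t *\<^sub>R v) - f p) / t
        + \<kappa> * (\<Sum>j\<in>UNIV. (norm (g (p + t *\<^sub>R v) $ j) - norm (g p $ j)) / t))
      = (\<lambda>t. (objective f \<kappa> g (p + t *\<^sub>R v) - objective f \<kappa> g p) / t)"
    by (simp add: objective_def reg_def fun_eq_iff sum_subtractf add_divide_distrib
        diff_divide_distrib right_diff_distrib flip: sum_divide_distrib)
  ultimately show ?thesis
    by simp
qed

text \<open>Here the points \<open>X l\<close> and the parameters \<open>e l\<close> are arbitrary; how they are generated does not
  matter.\<close>

lemma clarke_stationary_of_smoothed_gradients: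
  fixes f :: "'a::euclidean_space \<Rightarrow> real" and g :: "'a \<Rightarrow> (real^'d)^'m"
    and g' :: "'a \<Rightarrow> 'a \<Rightarrow>\<^sub>L ((real^'d)^'m)"
  assumes \<kappa>: "0 \<le> \<kappa>"
    and f: "\<And>y. f differentiable (at y)" "continuous_on UNIV (grad f)"
    and g: "\<And>y. (g has_derivative g' y) (at y)" "continuous_on UNIV g'"
    and X: "X \<longlonglongrightarrow> p" and e: "\<And>l. e l > 0" "e \<longlonglongrightarrow> 0"
    and G: "(\<lambda>l. grad (objective_smooth f \<kappa> g (e l)) (X l)) \<longlonglongrightarrow> 0"
  shows "clarke_stationary (objective f \<kappa> g) p"
  unfolding clarke_stationary_def clarke_subdiff_def
proof (intro CollectI allI)
  fix v
  \<comment> \<open>\<open>U j l\<close> bounds the contribution of block \<open>j\<close> to the smoothed derivative and converges to its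
     contribution \<open>L j\<close> to the directional derivative at \<open>p\<close>.\<close>
  define w where "w j l = (g (X l) $ j \<bullet> g' (X l) v $ j) / sqrt ((norm (g (X l) $ j))\<^sup>2 + (e l)\<^sup>2)"
    for j l
  define U where "U j l = (if g p $ j = 0 then norm (g' (X l) v $ j) else w j l)" for j l
  define L where "L j = (if g p $ j = 0 then norm (g' p v $ j)
    else (g p $ j \<bullet> g' p v $ j) / norm (g p $ j))" for j
  have lim_f: "(\<lambda>l. grad f (X l)) \<longlonglongrightarrow> grad f p"
    using continuous_on_tendsto_compose[OF f(2) X] by simp
  have lim_g': "(\<lambda>l. g' (X l)) \<longlonglongrightarrow> g' p"
    using continuous_on_tendsto_compose[OF g(2) X] by simp
  have lim_g: "(\<lambda>l. g (X l)) \<longlonglongrightarrow> g p"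
    using isCont_tendsto_compose[OF has_derivative_continuous[OF g(1)] X] .
  have w_le_U: "w j l \<le> U j l" for j l
  proof (cases "g p $ j = 0")
    case True
    have "\<bar>g (X l) $ j \<bullet> g' (X l) v $ j\<bar> \<le> norm (g (X l) $ j) * norm (g' (X l) v $ j)"
      by (rule Cauchy_Schwarz_ineq2)
    also have "\<dots> \<le> sqrt ((norm (g (X l) $ j))\<^sup>2 + (e l)\<^sup>2) * norm (g' (X l) v $ j)"
      by (intro mult_right_mono real_sqrt_sum_squares_ge1) auto
    finally have "g (X l) $ j \<bullet> g' (X l) v $ j
        \<le> norm (g' (X l) v $ j) * sqrt ((norm (g (X l) $ j))\<^sup>2 + (e l)\<^sup>2)"
      by (simp add: mult.commute)
    moreover have "sqrt ((norm (g (X l) $ j))\<^sup>2 + (e l)\<^sup>2) > 0"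
      using e(1)[of l] by (simp add: add_nonneg_pos)
    ultimately show ?thesis
      using True by (simp add: w_def U_def pos_divide_le_eq)
  qed (simp add: U_def)
  have lim_U: "U j \<longlonglongrightarrow> L j" for j
  proof (cases "g p $ j = 0")
    case True
    have "(\<lambda>l. norm (g' (X l) v $ j)) \<longlonglongrightarrow> norm (g' p v $ j)"
      by (intro tendsto_intros lim_g')
    with True show ?thesis
      by (simp add: U_def[abs_def] L_def)
  next
    case False
    have "(\<lambda>l. w j l) \<longlonglongrightarrow> (g p $ j \<bullet> g' p v $ j) / sqrt ((norm (g p $ j))\<^sup>2 + 0\<^sup>2)"
      unfolding w_def by (intro tendsto_intros lim_g lim_g' e(2)) (use False in auto)
    with False show ?thesis
      by (simp add: U_def[abs_def] L_def)
  qed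
  have "(\<lambda>l. v \<bullet> grad (objective_smooth f \<kappa> g (e l)) (X l)) \<longlonglongrightarrow> v \<bullet> 0"
    by (intro tendsto_intros G)
  moreover have "(\<lambda>l. v \<bullet> grad f (X l) + \<kappa> * (\<Sum>j\<in>UNIV. U j l))
      \<longlonglongrightarrow> v \<bullet> grad f p + \<kappa> * (\<Sum>j\<in>UNIV. L j)"
    by (intro tendsto_intros lim_f lim_U)
  moreover have "v \<bullet> grad (objective_smooth f \<kappa> g (e l)) (X l)
      \<le> v \<bullet> grad f (X l) + \<kappa> * (\<Sum>j\<in>UNIV. U j l)" for l
    unfolding inner_grad_objective_smooth[OF f(1) g(1) e(1)]
    by (intro add_left_mono mult_left_mono sum_mono \<kappa> w_le_U[unfolded w_def])
  ultimately have "v \<bullet> 0 \<le> v \<bullet> grad f p + \<kappa> * (\<Sum>j\<in>UNIV. L j)"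
    by (intro LIMSEQ_le) auto
  then have "ereal (0 \<bullet> v) \<le> ereal (v \<bullet> grad f p + \<kappa> * (\<Sum>j\<in>UNIV. L j))"
    by simp
  also have "\<dots> \<le> clarke_dderiv (objective f \<kappa> g) p v"
    unfolding L_def by (intro clarke_dderiv_ge objective_directional_derivative f(1) g(1))
  finally show "ereal (0 \<bullet> v) \<le> clarke_dderiv (objective f \<kappa> g) p v" .
qed

section \<open>Runs of the algorithm\<close>

lemma line_search_sufficient_decrease:
  "line_search F a \<rho> x \<alpha> y \<Longrightarrow> sufficient_decrease F a x y"
  by (induction rule: line_search.induct)

lemma iterate_step_nonincreasing:
  assumes "iterate_step f \<kappa> g a \<rho> \<epsilon> \<alpha> \<beta> x x'" "a > 0"
  shows "objective_smooth f \<kappa> g \<epsilon> x' \<le> objective_smooth f \<kappa> g \<epsilon> x"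
proof -
  have "sufficient_decrease (objective_smooth f \<kappa> g \<epsilon>) a x x'"
    using assms(1) line_search_sufficient_decrease
    by (auto simp: iterate_step_def Let_def split: if_splits)
  moreover have "0 \<le> 1 / a * (norm (x' - x))\<^sup>2"
    using \<open>a > 0\<close> by simp
  ultimately show ?thesis
    by (simp add: sufficient_decrease_def)
qed

lemma coercive_sublevel_bounded:
  assumes "coercive F"
  shows "bounded {y. F y \<le> c}"
proof -
  have "eventually (\<lambda>y. F y > c) at_infinity"
    using assms by (auto simp: coercive_def filterlim_at_top_dense)
  then obtain b where "\<And>y. norm y \<ge> b \<Longrightarrow> F y > c"
    by (auto simp: eventually_at_infinity)
  then have "norm y \<le> b" if "F y \<le> c" for y
    using that by (meson linorder_le_cases not_le)
  then show ?thesis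
    by (auto simp: bounded_iff)
qed

text \<open>An infinite run of the algorithm.  Only the acceptance tests matter for its analysis, so no
  condition is put on the step sizes or on the backtracking factor.\<close>

locale algorithm_run =
  fixes f :: "'a::euclidean_space \<Rightarrow> real" and \<kappa> :: real and g :: "'a \<Rightarrow> (real^'d)^'m"
    and a \<rho> \<sigma> \<gamma> tol \<epsilon>0 :: real and \<alpha> \<beta> \<epsilon> :: "nat \<Rightarrow> real" and x0 :: 'a and x :: "nat \<Rightarrow> 'a"
  assumes run: "generated_by_algorithm f \<kappa> g a \<rho> \<sigma> \<gamma> \<alpha> \<beta> tol x0 \<epsilon>0 x \<epsilon>"
    and params: "0 \<le> \<kappa>" "0 < \<gamma>" "\<gamma> < 1" "\<epsilon>0 > 0" "a > 0"
begin

lemma eps_Suc: "\<epsilon> (Suc t) = (if reduction_criterion f \<kappa> g \<sigma> \<gamma> x \<epsilon> t then \<gamma> * \<epsilon> t else \<epsilon> t)"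
  and step: "iterate_step f \<kappa> g a \<rho> (\<epsilon> t) (\<alpha> t) (\<beta> t) (x t) (x (Suc t))"
  using run by (auto simp: generated_by_algorithm_def)

lemma eps_pos: "\<epsilon> t > 0"
proof (induction t)
  case 0
  then show ?case
    using run params by (simp add: generated_by_algorithm_def)
next
  case (Suc t)
  then show ?case
    using params by (simp add: eps_Suc)
qed

lemma eps_antimono: "decseq \<epsilon>"
  using eps_pos params by (intro decseq_SucI) (simp add: eps_Suc mult_le_cancel_right1 less_imp_le)

lemma shifted_objective_antimono: "decseq (\<lambda>t. shifted_objective f \<kappa> g (\<epsilon> t) (x t))"
proof (rule decseq_SucI)
  fix t
  have "shifted_objective f \<kappa> g (\<epsilon> (Suc t)) (x (Suc t)) \<le> shifted_objective f \<kappa> g (\<epsilon> t) (x (Suc t))"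
    using eps_pos[of "Suc t"] decseq_SucD[OF eps_antimono, of t] params
    by (intro shifted_objective_mono) auto
  also have "\<dots> \<le> shifted_objective f \<kappa> g (\<epsilon> t) (x t)"
    using iterate_step_nonincreasing[OF step] params by (simp add: shifted_objective_eq)
  finally show "shifted_objective f \<kappa> g (\<epsilon> (Suc t)) (x (Suc t))
      \<le> shifted_objective f \<kappa> g (\<epsilon> t) (x t)" .
qed

lemma iterates_bounded:
  assumes "coercive (objective f \<kappa> g)"
  shows "bounded (range x)"
proof (rule bounded_subset[OF coercive_sublevel_bounded[OF assms]])
  have "objective f \<kappa> g (x t) \<le> shifted_objective f \<kappa> g (\<epsilon> 0) (x 0)" for t
  proof -
    have "objective f \<kappa> g (x t) \<le> shifted_objective f \<kappa> g (\<epsilon> t) (x t)"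
      using eps_pos[of t] params unfolding shifted_objective_zero[symmetric]
      by (intro shifted_objective_mono) auto
    also have "\<dots> \<le> shifted_objective f \<kappa> g (\<epsilon> 0) (x 0)"
      using decseqD[OF shifted_objective_antimono, of 0 t] by simp
    finally show ?thesis .
  qed
  then show "range x \<subseteq> {y. objective f \<kappa> g y \<le> shifted_objective f \<kappa> g (\<epsilon> 0) (x 0)}"
    by auto
qed

lemma eps_reductions_tendsto_0:
  assumes "strict_mono s" and red: "\<And>l. reduction_criterion f \<kappa> g \<sigma> \<gamma> x \<epsilon> (s l)"
  shows "(\<lambda>l. \<epsilon> (s l)) \<longlonglongrightarrow> 0"
proof -
  have "\<epsilon> (s l) \<le> \<epsilon> (s 0) * \<gamma> ^ l" for l
  proof (induction l)
    case (Suc l)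
    have "\<epsilon> (s (Suc l)) \<le> \<epsilon> (Suc (s l))"
      using strict_monoD[OF assms(1), of l "Suc l"] by (intro decseqD[OF eps_antimono]) auto
    also have "\<dots> = \<gamma> * \<epsilon> (s l)"
      using red by (simp add: eps_Suc)
    also have "\<dots> \<le> \<gamma> * (\<epsilon> (s 0) * \<gamma> ^ l)"
      using Suc params by (intro mult_left_mono) auto
    finally show ?case
      by (simp add: algebra_simps)
  qed simp
  moreover have "(\<lambda>l. \<epsilon> (s 0) * \<gamma> ^ l) \<longlonglongrightarrow> 0"
    using params by (intro tendsto_mult_right_zero LIMSEQ_power_zero) simp
  ultimately show ?thesis
    using eps_pos
    by (intro Lim_null_comparison[of "\<lambda>l. \<epsilon> (s l)"] always_eventually) (simp_all add: abs_of_pos)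
qed

end

theorem theorem4p1:
  fixes f :: "'a::euclidean_space \<Rightarrow> real"
    and g :: "'a \<Rightarrow> (real^'d)^'m"
    and g' :: "'a \<Rightarrow> 'a \<Rightarrow>\<^sub>L ((real^'d)^'m)"
    and \<kappa> L\<^sub>f L\<^sub>g M \<rho> \<gamma> \<epsilon>0 a \<sigma> :: real
    and \<alpha> \<beta> \<epsilon> :: "nat \<Rightarrow> real"
    and x0 :: 'a
    and x :: "nat \<Rightarrow> 'a"
    and s :: "nat \<Rightarrow> nat"
  assumes kappa: "0 < \<kappa>" "\<kappa> < 1"
    and a1: "\<forall>y. f differentiable (at y)" "L\<^sub>f-lipschitz_on UNIV (grad f)"
    and a2: "\<forall>y. (g has_derivative blinfun_apply (g' y)) (at y)" "L\<^sub>g-lipschitz_on UNIV g'"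
    and a3: "M > 0" "\<forall>y. norm (g' y) \<le> M"
    and a4: "coercive (objective f \<kappa> g)"
            "\<exists>y0. \<forall>y. objective f \<kappa> g y0 \<le> objective f \<kappa> g y"
    and params: "0 < \<rho>" "\<rho> < 1" "0 < \<gamma>" "\<gamma> < 1" "\<epsilon>0 > 0" "a > 0" "\<sigma> > 0"
    and step_sizes: "\<forall>t. \<alpha> t > 0" "\<forall>t. \<beta> t > 0"
    and run: "generated_by_algorithm f \<kappa> g a \<rho> \<sigma> \<gamma> \<alpha> \<beta> 0 x0 \<epsilon>0 x \<epsilon>"
    and subseq: "strict_mono s" "range s = {t. reduction_criterion f \<kappa> g \<sigma> \<gamma> x \<epsilon> t}"
  shows "(\<exists>p. accumulation_point (\<lambda>l. x (s l + 1)) p) \<and>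
         (\<forall>p. accumulation_point (\<lambda>l. x (s l + 1)) p \<longrightarrow>
              clarke_stationary (objective f \<kappa> g) p)"
proof -
  interpret algorithm_run f \<kappa> g a \<rho> \<sigma> \<gamma> 0 \<epsilon>0 \<alpha> \<beta> \<epsilon> x0 x
    using run kappa params by unfold_locales auto
  have red: "reduction_criterion f \<kappa> g \<sigma> \<gamma> x \<epsilon> (s l)" for l
    using subseq(2) by auto
  have "bounded (range (\<lambda>l. x (s l + 1)))"
    using iterates_bounded[OF a4(1)] by (rule bounded_subset) auto
  then have "\<exists>p. accumulation_point (\<lambda>l. x (s l + 1)) p"
    unfolding accumulation_point_def using bounded_imp_convergent_subsequence by blast
  moreover have "clarke_stationary (objective f \<kappa> g) p"
    if acc: "accumulation_point (\<lambda>l. x (s l + 1)) p" for p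
  proof -
    obtain q where q: "strict_mono q" and lim: "(\<lambda>l. x (s (q l) + 1)) \<longlonglongrightarrow> p"
      using acc unfolding accumulation_point_def comp_def by blast
    have e: "(\<lambda>l. \<epsilon> (s (q l))) \<longlonglongrightarrow> 0"
      using LIMSEQ_subseq_LIMSEQ[OF eps_reductions_tendsto_0[OF subseq(1) red] q]
      by (simp add: comp_def)
    then have "(\<lambda>l. \<sigma> * \<gamma> * \<epsilon> (s (q l))) \<longlonglongrightarrow> 0"
      by (rule tendsto_mult_right_zero)
    moreover have "norm (grad (objective_smooth f \<kappa> g (\<epsilon> (s (q l)))) (x (s (q l) + 1)))
        \<le> \<sigma> * \<gamma> * \<epsilon> (s (q l))" for l
      using red[of "q l"] by (simp add: reduction_criterion_def)
    ultimately have "(\<lambda>l. grad (objective_smooth f \<kappa> g (\<epsilon> (s (q l)))) (x (s (q l) + 1))) \<longlonglongrightarrow> 0"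
      by (rule Lim_null_comparison[OF always_eventually[OF allI], rotated])
    moreover have "continuous_on UNIV (grad f)" "continuous_on UNIV g'"
      using lipschitz_on_continuous_on[OF a1(2)] lipschitz_on_continuous_on[OF a2(2)] .
    ultimately show ?thesis
      using kappa(1) a1(1) a2(1) lim e eps_pos
      by (intro clarke_stationary_of_smoothed_gradients[of \<kappa> f g g' _ p "\<lambda>l. \<epsilon> (s (q l))"])
         (simp_all only: less_imp_le)
  qed
  ultimately show ?thesis
    by blast
qed

end
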